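(* Let $\Theta\subset\mathbb{R}^m$ and $f:\mathbb{R}^n\times\Theta\to\mathbb{R}$ satisfy the regularity and definability assumptions, let $O\subset\Theta$ be open and definable, and assume the uniform range condition holds on $O$ with $\bar\varepsilon>0$ and a definable conservative Jacobian $J_F$ of $F=\nabla_xf$ (all defined in the context). Fix $\theta\in O$ and suppose that at least one of the following holds at $\theta$: (Spectral gap) there exist $\lambda^*>0$ and $\varepsilon_G\in\,]0,\bar\varepsilon]$ such that, for every $0<\varepsilon\le\varepsilon_G$ and every $(H_\varepsilon\ M_\varepsilon)\in J_F(x^\star_\varepsilon(\theta),\theta)$, $\operatorname{spec}(H_\varepsilon)\subset\{0\}\cup[\lambda^*,+\infty[$; (Fast vanishing) for every sequence $\varepsilon_k\downarrow0$ with $0<\varepsilon_k\le\bar\varepsilon$ and every selection $(H_k\ M_k)\in J_F(x^\star_{\varepsilon_k}(\theta),\theta)$ such that $(H_k)_k$ converges, the ordered eigenvalues $\lambda_1(H_k)\ge\dots\ge\lambda_n(H_k)$ satisfy, for $i=1,\dots,n$: $\lambda_i(H_k)\to0\Rightarrow\lambda_i(H_k)=o(\varepsilon_k)$. Then $$\{-H^\dagger M:(H\ M)\in\mathcal{R}(\theta)\}\subset J_{x^\star_{\min}}(\theta).$$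
   Context: Definability is relative to a fixed o-minimal structure expanding the real field; a (set-valued) map is definable if its graph is. $\|\cdot\|$ is the Euclidean/operator norm, $\dagger$ the Moore–Penrose pseudoinverse. Conservative Jacobian: for $U\subset\mathbb{R}^d$ open and $G:U\to\mathbb{R}^q$ locally Lipschitz, $J_G:U\rightrightarrows\mathbb{R}^{q\times d}$ is a conservative Jacobian of $G$ on $U$ if it is nonempty-valued, locally bounded, has closed graph, and for every absolutely continuous curve $\mu:[0,1]\to U$ and almost every $t$, $\frac{d}{dt}G(\mu(t))=V\dot\mu(t)$ for all $V\in J_G(\mu(t))$. Regularity assumption: for every $\theta\in\Theta$, $f(\cdot,\theta)$ is $\mathcal{C}^{1,1}(\mathbb{R}^n)$ (differentiable with Lipschitz gradient), convex, and $\mathcal{S}(\theta):=\operatorname{argmin}_xf(x,\theta)\ne\emptyset$; and $F:=\nabla_xf$ is locally Lipschitz jointly in $(x,\theta)$. Definability assumption: $f$ and $\Theta$ are definable. $x^\star_{\min}(\theta)$ is the minimal Euclidean norm element of $\mathcal{S}(\theta)$; for $\varepsilon>0$, $x^\star_\varepsilon(\theta)$ is the unique minimizer of $x\mapsto f(x,\theta)+\frac{\varepsilon}{2}\|x\|_2^2$. Elements of $J_F(x,\theta)$ are written $(H\ M)$ with $H\in\mathbb{R}^{n\times n}$ ($x$-block), $M\in\mathbb{R}^{n\times m}$ ($\theta$-block). Uniform range condition: for every compact $K\subset O$ there exists $C_K>0$ such that, for every $\theta\in K$, $0<\varepsilon\le\bar\varepsilon$ and $(H_\varepsilon\ M_\varepsilon)\in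 J_F(x^\star_\varepsilon(\theta),\theta)$, the block $H_\varepsilon$ is symmetric positive semidefinite and $M_\varepsilon=H_\varepsilon W_\varepsilon$ for some $W_\varepsilon\in\mathbb{R}^{n\times m}$ with $\|W_\varepsilon\|\le C_K$. For $0<\varepsilon\le\bar\varepsilon$: $J_{x^\star_\varepsilon}(\theta):=\{-(H_\varepsilon+\varepsilon I_n)^{-1}M_\varepsilon:(H_\varepsilon\ M_\varepsilon)\in J_F(x^\star_\varepsilon(\theta),\theta)\}$. $J_{x^\star_{\min}}(\theta)$ is the set of $V\in\mathbb{R}^{n\times m}$ for which there exist $\theta_k\in O$, $\theta_k\to\theta$, $\varepsilon_k\downarrow0$ ($0<\varepsilon_k\le\bar\varepsilon$), $V_k\to V$ with $V_k\in J_{x^\star_{\varepsilon_k}}(\theta_k)$ and $x^\star_{\varepsilon_k}(\theta_k)\to x^\star_{\min}(\theta)$. Reachable set: $\mathcal{R}(\theta)$ is the set of $(H\ M)\in J_F(x^\star_{\min}(\theta),\theta)$ for which there exist $\varepsilon_k\downarrow0$ and $(H_k\ M_k)\in J_F(x^\star_{\varepsilon_k}(\theta),\theta)$ with $(H_k\ M_k)\to(H\ M)$. *)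

theory Defs
  imports
    "HOL-Analysis.Analysis"
    "HOL-Computational_Algebra.Polynomial"
    "HOL-Library.Landau_Symbols"
begin

section \<open>O-minimal structures and definability\<close>

text \<open>
  A point of the \<open>n\<close>-th power of the reals is a real list of length \<open>n\<close>, and \<open>D n\<close> is the
  family of definable subsets of that power.  The axioms are those of van den Dries.  All real
  parameters are available, because \<open>D 1\<close> contains every singleton.
\<close>

definition o_minimal_structure :: "(nat \<Rightarrow> real list set set) \<Rightarrow> bool" where
  "o_minimal_structure D \<longleftrightarrow>
     (\<forall>n. D n \<subseteq> Pow {xs. length xs = n}) \<and>
     (\<forall>n. {} \<in> D n) \<and>
     (\<forall>n. \<forall>A\<in>D n. \<forall>B\<in>D n. A \<union> B \<in> D n) \<and>
     (\<forall>n. \<forall>A\<in>D n. {xs. length xs = n} - A \<in> D n) \<and>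
     (\<forall>n. \<forall>A\<in>D n. {x # xs | x xs. xs \<in> A} \<in> D (Suc n) \<and> {xs @ [x] | x xs. xs \<in> A} \<in> D (Suc n)) \<and>
     (\<forall>n\<ge>1. {xs. length xs = n \<and> hd xs = last xs} \<in> D n) \<and>
     (\<forall>n. \<forall>A\<in>D (Suc n). butlast ` A \<in> D n) \<and>
     {[x, y] | x y. x < y} \<in> D 2 \<and>
     {[x, y, x + y] | x y. True} \<in> D 3 \<and>
     {[x, y, x * y] | x y. True} \<in> D 3 \<and>
     D 1 = {(\<lambda>x. [x]) ` (\<Union>F) | F. finite F \<and> (\<forall>I\<in>F. is_interval I)}"

text \<open>
  Subsets of an arbitrary Euclidean space are read in coordinates.  Definable families are closed
  under permutation of the coordinates, so the enumeration of the basis is irrelevant.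
\<close>

definition definable :: "(nat \<Rightarrow> real list set set) \<Rightarrow> 'a::euclidean_space set \<Rightarrow> bool" where
  "definable D S \<longleftrightarrow>
     (\<exists>bs. distinct bs \<and> set bs = Basis \<and> (\<lambda>x. map (\<lambda>b. x \<bullet> b) bs) ` S \<in> D DIM('a))"

definition definable_map ::
  "(nat \<Rightarrow> real list set set) \<Rightarrow> 'a::euclidean_space set \<Rightarrow> ('a \<Rightarrow> 'b::euclidean_space) \<Rightarrow> bool" where
  "definable_map D S g \<longleftrightarrow> definable D {(x, g x) | x. x \<in> S}"

definition definable_setmap ::
  "(nat \<Rightarrow> real list set set) \<Rightarrow> 'a::euclidean_space set \<Rightarrow> ('a \<Rightarrow> 'b::euclidean_space set) \<Rightarrow> bool" where
  "definable_setmap D S J \<longleftrightarrow> definable D {(x, v) | x v. x \<in> S \<and> v \<in> J x}"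


section \<open>Regularity\<close>

definition gradient :: "('a::real_inner \<Rightarrow> real) \<Rightarrow> 'a \<Rightarrow> 'a" where
  "gradient g x = (THE d. GDERIV g x :> d)"

definition C11 :: "('a::real_inner \<Rightarrow> real) \<Rightarrow> bool" where
  "C11 g \<longleftrightarrow> (\<forall>x. g differentiable (at x)) \<and> (\<exists>L. L-lipschitz_on UNIV (gradient g))"

definition locally_lipschitz_on :: "'a::metric_space set \<Rightarrow> ('a \<Rightarrow> 'b::metric_space) \<Rightarrow> bool" where
  "locally_lipschitz_on S g \<longleftrightarrow> (\<forall>z\<in>S. \<exists>r>0. \<exists>L. L-lipschitz_on (ball z r \<inter> S) g)"

text \<open>
  The space of pairs \<open>(x, \<theta>)\<close> is \<^typ>\<open>real ^ ('n + 'm)\<close>, so that Jacobians with respect to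
  \<open>(x, \<theta>)\<close> are matrices \<open>(H M)\<close> with \<open>n\<close> rows and \<open>n + m\<close> columns.
\<close>

definition vjoin :: "real ^ 'n \<Rightarrow> real ^ 'm \<Rightarrow> real ^ ('n + 'm)" where
  "vjoin x \<theta> = (\<chi> i. case i of Inl a \<Rightarrow> x $ a | Inr b \<Rightarrow> \<theta> $ b)"

definition xpart :: "real ^ ('n + 'm::finite) \<Rightarrow> real ^ 'n" where
  "xpart z = (\<chi> a. z $ Inl a)"

definition tpart :: "real ^ ('n::finite + 'm) \<Rightarrow> real ^ 'm" where
  "tpart z = (\<chi> b. z $ Inr b)"

definition Hblock :: "real ^ ('n + 'm::finite) ^ 'n \<Rightarrow> real ^ 'n ^ 'n" where
  "Hblock A = (\<chi> i. xpart (A $ i))"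

definition Mblock :: "real ^ ('n + 'm) ^ 'n \<Rightarrow> real ^ 'm ^ 'n" where
  "Mblock A = (\<chi> i. tpart (A $ i))"

definition cylinder :: "(real ^ 'm) set \<Rightarrow> (real ^ ('n::finite + 'm)) set" where
  "cylinder T = {vjoin x \<theta> | x \<theta>. \<theta> \<in> T}"

definition grad_x :: "(real ^ 'n \<Rightarrow> real ^ 'm \<Rightarrow> real) \<Rightarrow> real ^ ('n + 'm) \<Rightarrow> real ^ 'n" where
  "grad_x f z = gradient (\<lambda>x. f x (tpart z)) (xpart z)"

definition solutions :: "(real ^ 'n \<Rightarrow> real ^ 'm \<Rightarrow> real) \<Rightarrow> real ^ 'm \<Rightarrow> (real ^ 'n) set" where
  "solutions f \<theta> = {x. is_arg_min (\<lambda>x. f x \<theta>) (\<lambda>_. True) x}"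

definition regularity :: "(real ^ 'm) set \<Rightarrow> (real ^ 'n \<Rightarrow> real ^ 'm \<Rightarrow> real) \<Rightarrow> bool" where
  "regularity \<Theta> f \<longleftrightarrow>
     (\<forall>\<theta>\<in>\<Theta>. C11 (\<lambda>x. f x \<theta>) \<and> convex_on UNIV (\<lambda>x. f x \<theta>) \<and> solutions f \<theta> \<noteq> {}) \<and>
     locally_lipschitz_on (cylinder \<Theta>) (grad_x f)"

definition x_min :: "(real ^ 'n \<Rightarrow> real ^ 'm \<Rightarrow> real) \<Rightarrow> real ^ 'm \<Rightarrow> real ^ 'n" where
  "x_min f \<theta> = arg_min_on norm (solutions f \<theta>)"

definition x_eps :: "(real ^ 'n \<Rightarrow> real ^ 'm \<Rightarrow> real) \<Rightarrow> real \<Rightarrow> real ^ 'm \<Rightarrow> real ^ 'n" where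
  "x_eps f \<epsilon> \<theta> = arg_min (\<lambda>x. f x \<theta> + \<epsilon> / 2 * (norm x)\<^sup>2) (\<lambda>_. True)"


section \<open>Conservative Jacobians\<close>

definition absolutely_continuous_curve :: "(real \<Rightarrow> 'a::real_normed_vector) \<Rightarrow> bool" where
  "absolutely_continuous_curve \<mu> \<longleftrightarrow>
     (\<forall>e>0. \<exists>d>0. \<forall>P :: (real \<times> real) set.
        finite P \<longrightarrow> (\<forall>(a, b)\<in>P. 0 \<le> a \<and> a \<le> b \<and> b \<le> 1) \<longrightarrow>
        disjoint_family_on (\<lambda>(a, b). {a<..<b}) P \<longrightarrow>
        (\<Sum>(a, b)\<in>P. b - a) < d \<longrightarrow>
        (\<Sum>(a, b)\<in>P. norm (\<mu> b - \<mu> a)) < e)"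

text \<open>
  The graph is closed relative to \<open>U \<times> \<real>\<^bsup>q\<times>d\<^esup>\<close>, and values of \<open>J\<close> outside \<open>U\<close> play no role.
\<close>

definition conservative_jacobian ::
  "(real ^ 'd) set \<Rightarrow> (real ^ 'd \<Rightarrow> real ^ 'q) \<Rightarrow> (real ^ 'd \<Rightarrow> (real ^ 'd ^ 'q) set) \<Rightarrow> bool" where
  "conservative_jacobian U G J \<longleftrightarrow>
     open U \<and> locally_lipschitz_on U G \<and>
     (\<forall>z\<in>U. J z \<noteq> {}) \<and>
     (\<forall>z\<in>U. \<exists>r>0. bounded (\<Union>w\<in>ball z r \<inter> U. J w)) \<and>
     closedin (top_of_set (U \<times> UNIV)) {(z, V) | z V. z \<in> U \<and> V \<in> J z} \<and>
     (\<forall>\<mu>. absolutely_continuous_curve \<mu> \<and> \<mu> ` {0..1} \<subseteq> U \<longrightarrow>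
        (AE t in lebesgue_on {0..1}. \<exists>v. (\<mu> has_vector_derivative v) (at t within {0..1}) \<and>
           (\<forall>V\<in>J (\<mu> t). ((\<lambda>s. G (\<mu> s)) has_vector_derivative (V *v v)) (at t within {0..1}))))"


section \<open>Matrix notions\<close>

definition symmetric_psd :: "real ^ 'n ^ 'n \<Rightarrow> bool" where
  "symmetric_psd H \<longleftrightarrow> transpose H = H \<and> (\<forall>v. 0 \<le> v \<bullet> (H *v v))"

text \<open>The Moore--Penrose pseudoinverse, characterised by the four Penrose equations.\<close>

definition pinv :: "real ^ 'n ^ 'm \<Rightarrow> real ^ 'm ^ 'n" where
  "pinv A = (THE X. A ** X ** A = A \<and> X ** A ** X = X \<and>
                    transpose (A ** X) = A ** X \<and> transpose (X ** A) = X ** A)"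

text \<open>
  Only real eigenvalues are recorded; all matrices to which these notions are applied are symmetric
  by the uniform range condition.
\<close>

definition spec :: "real ^ 'n ^ 'n \<Rightarrow> real set" where
  "spec H = {l. \<exists>v. v \<noteq> 0 \<and> H *v v = l *\<^sub>R v}"

definition charpoly :: "real ^ 'n ^ 'n \<Rightarrow> real poly" where
  "charpoly H = det (\<chi> i j. (if i = j then [:0, 1:] else 0) - [:H $ i $ j:])"

text \<open>
  \<open>eig H i\<close>, for \<open>1 \<le> i \<le> n\<close>, is the \<open>i\<close>-th largest eigenvalue counted with multiplicity.
\<close>

definition eig :: "real ^ 'n ^ 'n \<Rightarrow> nat \<Rightarrow> real" where
  "eig H i = rev (sorted_list_of_multiset (proots (charpoly H))) ! (i - 1)"


section \<open>Hypotheses and set-valued derivatives\<close>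

text \<open>
  In the following, \<open>JF\<close> is a conservative Jacobian of \<open>grad_x f\<close> and \<open>eb\<close> is the upper bound
  on the regularisation parameter.
\<close>

definition decreases_to_zero :: "(nat \<Rightarrow> real) \<Rightarrow> bool" where
  "decreases_to_zero \<epsilon> \<longleftrightarrow> (\<forall>k. 0 < \<epsilon> k) \<and> decseq \<epsilon> \<and> \<epsilon> \<longlonglongrightarrow> 0"

definition uniform_range_condition ::
  "(real ^ 'n \<Rightarrow> real ^ 'm \<Rightarrow> real) \<Rightarrow> (real ^ ('n + 'm) \<Rightarrow> (real ^ ('n + 'm) ^ 'n) set) \<Rightarrow>
   (real ^ 'm) set \<Rightarrow> real \<Rightarrow> bool" where
  "uniform_range_condition f JF Om eb \<longleftrightarrow>
     (\<forall>K. compact K \<and> K \<subseteq> Om \<longrightarrow>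
        (\<exists>C>0. \<forall>\<theta>\<in>K. \<forall>\<epsilon>. 0 < \<epsilon> \<and> \<epsilon> \<le> eb \<longrightarrow>
           (\<forall>A\<in>JF (vjoin (x_eps f \<epsilon> \<theta>) \<theta>).
              symmetric_psd (Hblock A) \<and>
              (\<exists>W. Mblock A = Hblock A ** W \<and> onorm (\<lambda>v. W *v v) \<le> C))))"

definition J_eps ::
  "(real ^ 'n \<Rightarrow> real ^ 'm \<Rightarrow> real) \<Rightarrow> (real ^ ('n + 'm) \<Rightarrow> (real ^ ('n + 'm) ^ 'n) set) \<Rightarrow>
   real \<Rightarrow> real ^ 'm \<Rightarrow> (real ^ 'm ^ 'n) set" where
  "J_eps f JF \<epsilon> \<theta> =
     {- (matrix_inv (Hblock A + \<epsilon> *\<^sub>R mat 1) ** Mblock A) | A. A \<in> JF (vjoin (x_eps f \<epsilon> \<theta>) \<theta>)}"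

definition J_min ::
  "(real ^ 'n \<Rightarrow> real ^ 'm \<Rightarrow> real) \<Rightarrow> (real ^ ('n + 'm) \<Rightarrow> (real ^ ('n + 'm) ^ 'n) set) \<Rightarrow>
   (real ^ 'm) set \<Rightarrow> real \<Rightarrow> real ^ 'm \<Rightarrow> (real ^ 'm ^ 'n) set" where
  "J_min f JF Om eb \<theta> =
     {V. \<exists>\<theta>s \<epsilon> Vs. (\<forall>k. \<theta>s k \<in> Om) \<and> \<theta>s \<longlonglongrightarrow> \<theta> \<and>
           decreases_to_zero \<epsilon> \<and> (\<forall>k. \<epsilon> k \<le> eb) \<and>
           Vs \<longlonglongrightarrow> V \<and> (\<forall>k. Vs k \<in> J_eps f JF (\<epsilon> k) (\<theta>s k)) \<and>
           (\<lambda>k. x_eps f (\<epsilon> k) (\<theta>s k)) \<longlonglongrightarrow> x_min f \<theta>}"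

definition reachable ::
  "(real ^ 'n \<Rightarrow> real ^ 'm \<Rightarrow> real) \<Rightarrow> (real ^ ('n + 'm) \<Rightarrow> (real ^ ('n + 'm) ^ 'n) set) \<Rightarrow>
   real ^ 'm \<Rightarrow> (real ^ ('n + 'm) ^ 'n) set" where
  "reachable f JF \<theta> =
     {A \<in> JF (vjoin (x_min f \<theta>) \<theta>). \<exists>\<epsilon> As. decreases_to_zero \<epsilon> \<and>
           (\<forall>k. As k \<in> JF (vjoin (x_eps f (\<epsilon> k) \<theta>) \<theta>)) \<and> As \<longlonglongrightarrow> A}"

definition spectral_gap ::
  "(real ^ 'n \<Rightarrow> real ^ 'm \<Rightarrow> real) \<Rightarrow> (real ^ ('n + 'm) \<Rightarrow> (real ^ ('n + 'm) ^ 'n) set) \<Rightarrow>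
   real \<Rightarrow> real ^ 'm \<Rightarrow> bool" where
  "spectral_gap f JF eb \<theta> \<longleftrightarrow>
     (\<exists>l>0. \<exists>eG. 0 < eG \<and> eG \<le> eb \<and>
        (\<forall>\<epsilon>. 0 < \<epsilon> \<and> \<epsilon> \<le> eG \<longrightarrow>
           (\<forall>A\<in>JF (vjoin (x_eps f \<epsilon> \<theta>) \<theta>). spec (Hblock A) \<subseteq> {0} \<union> {l..})))"

definition fast_vanishing ::
  "(real ^ 'n \<Rightarrow> real ^ 'm \<Rightarrow> real) \<Rightarrow> (real ^ ('n + 'm) \<Rightarrow> (real ^ ('n + 'm) ^ 'n) set) \<Rightarrow>
   real \<Rightarrow> real ^ 'm \<Rightarrow> bool" where
  "fast_vanishing f JF eb \<theta> \<longleftrightarrow>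
     (\<forall>\<epsilon> As. decreases_to_zero \<epsilon> \<and> (\<forall>k. \<epsilon> k \<le> eb) \<and>
        (\<forall>k. As k \<in> JF (vjoin (x_eps f (\<epsilon> k) \<theta>) \<theta>)) \<and> convergent (\<lambda>k. Hblock (As k)) \<longrightarrow>
        (\<forall>i\<in>{1..CARD('n)}. (\<lambda>k. eig (Hblock (As k)) i) \<longlonglongrightarrow> 0 \<longrightarrow>
           (\<lambda>k. eig (Hblock (As k)) i) \<in> o(\<epsilon>)))"

end

theory Submission
  imports Defs
begin

text \<open>
  Keep the parameter \<open>\<theta>\<close> fixed and diagonalise \<open>H\<^sub>k = P\<^sub>k\<^sup>T diag(d\<^sub>k) P\<^sub>k\<close> with \<open>P\<^sub>k\<close> orthogonal. Along a
  subsequence \<open>P\<^sub>k\<close>, \<open>d\<^sub>k\<close> and the bounded factors \<open>W\<^sub>k\<close> of \<open>M\<^sub>k = H\<^sub>k W\<^sub>k\<close> converge. Then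
  \<open>(H\<^sub>k + \<epsilon>\<^sub>k I)\<^sup>-\<^sup>1 M\<^sub>k = P\<^sub>k\<^sup>T diag(d\<^sub>k / (d\<^sub>k + \<epsilon>\<^sub>k)) P\<^sub>k W\<^sub>k\<close>, and either hypothesis on the spectrum forces
  \<open>d\<^sub>k / (d\<^sub>k + \<epsilon>\<^sub>k)\<close> to tend to \<open>0\<close> where \<open>d\<^sub>k\<close> vanishes in the limit and to \<open>1\<close> elsewhere. The limit is
  thus the projector \<open>H\<^sup>\<dagger>H\<close> applied to \<open>lim W\<^sub>k\<close>, which is \<open>H\<^sup>\<dagger>M\<close>.
\<close>

section \<open>Orthogonal diagonalisation of symmetric matrices\<close>

text \<open>
  On an invariant subspace, a maximiser of the Rayleigh quotient on the unit sphere is an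
  eigenvector.
\<close>

lemma selfadjoint_eigenvector:
  fixes T :: "'a::euclidean_space \<Rightarrow> 'a"
  assumes lin: "linear T" and sa: "\<And>x y. T x \<bullet> y = x \<bullet> T y"
    and S: "subspace S" and inv: "\<And>x. x \<in> S \<Longrightarrow> T x \<in> S" and nz: "\<exists>x\<in>S. x \<noteq> 0"
  shows "\<exists>v\<in>S. norm v = 1 \<and> (\<exists>l. T v = l *\<^sub>R v)"
proof -
  interpret linear T by (rule lin)
  obtain x where x: "x \<in> S" "x \<noteq> 0" using nz by blast
  let ?K = "sphere 0 1 \<inter> S"
  have "(1 / norm x) *\<^sub>R x \<in> ?K" using x S by (simp add: subspace_scale)
  moreover have "compact ?K" by (simp add: S closed_subspace compact_Int_closed)
  moreover have "continuous_on ?K (\<lambda>w. w \<bullet> T w)"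
    by (intro continuous_intros linear_continuous_on linear_conv_bounded_linear[THEN iffD1] lin)
  ultimately obtain v where v: "v \<in> ?K" and max: "\<And>w. w \<in> ?K \<Longrightarrow> w \<bullet> T w \<le> v \<bullet> T v"
    using continuous_attains_sup[of ?K "\<lambda>w. w \<bullet> T w"] by blast
  define l where "l = v \<bullet> T v"
  have vS: "v \<in> S" and nv: "norm v = 1" "v \<bullet> v = 1" using v by (auto simp: norm_eq_1)
  have ray: "w \<bullet> T w \<le> l * (w \<bullet> w)" if "w \<in> S" for w
  proof (cases "w = 0")
    case False
    have "(1 / norm w) *\<^sub>R w \<in> ?K" using False that S by (simp add: subspace_scale)
    from max[OF this] have "(w \<bullet> T w) / (norm w)\<^sup>2 \<le> l"
      by (simp add: scale l_def power2_eq_square)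
    then show ?thesis using False by (simp add: field_simps power2_norm_eq_inner)
  qed (simp add: zero)
  define u where "u = T v - l *\<^sub>R v"
  have uS: "u \<in> S" using vS inv S by (simp add: u_def subspace_diff subspace_scale)
  \<comment> \<open>This is \<open>ray\<close> at \<open>v + t *\<^sub>R u\<close>. Self-adjointness
    and \<open>T v = u + l *\<^sub>R v\<close> make the coefficient of \<open>t\<close> equal to
    \<open>2 * (u \<bullet> u)\<close>.\<close>
  have le: "2 * t * (u \<bullet> u) + t\<^sup>2 * (u \<bullet> T u - l * (u \<bullet> u)) \<le> 0" for t
  proof -
    have w: "v + t *\<^sub>R u \<in> S" using vS uS S by (simp add: subspace_add subspace_scale)
    have Tvu: "T v \<bullet> u = u \<bullet> u + l * (v \<bullet> u)" by (simp add: u_def inner_diff_left)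
    have "v \<bullet> T u = T v \<bullet> u" by (simp add: sa)
    then show ?thesis
      using ray[OF w] Tvu nv
      by (simp add: add scale inner_add_left inner_add_right inner_commute l_def
          power2_eq_square algebra_simps)
  qed
  have "u \<bullet> u = 0"
  proof (rule ccontr)
    assume "u \<bullet> u \<noteq> 0"
    then have pos: "u \<bullet> u > 0" by simp
    \<comment> \<open>With this \<open>c\<close>, the choice \<open>t = (u \<bullet> u) / c\<close>
      bounds the quadratic term by \<open>t * (u \<bullet> u)\<close>, half of the linear one. The
      added 1 keeps \<open>c\<close> positive.\<close>
    define c where "c = \<bar>u \<bullet> T u - l * (u \<bullet> u)\<bar> + 1"
    have c: "c > 0" by (simp add: c_def)
    define t where "t = (u \<bullet> u) / c"
    have t: "t > 0" using pos c by (simp add: t_def)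
    have "t\<^sup>2 * (- c) \<le> t\<^sup>2 * (u \<bullet> T u - l * (u \<bullet> u))"
      by (intro mult_left_mono) (auto simp: c_def)
    then have "2 * t * (u \<bullet> u) \<le> t\<^sup>2 * c" using le[of t] by linarith
    also have "\<dots> = t * (u \<bullet> u)" using c by (simp add: t_def power2_eq_square)
    finally show False using t pos mult_pos_pos[OF t pos] by linarith
  qed
  then have "T v = l *\<^sub>R v" by (simp add: u_def)
  then show ?thesis using vS nv by blast
qed

text \<open>Induction on the dimension: a unit eigenvector \<open>v\<close> is split off, and
  self-adjointness makes its orthogonal complement within \<open>S\<close> invariant, so the
  induction hypothesis applies there.\<close>

lemma selfadjoint_orthonormal_eigenbasis:
  fixes T :: "'a::euclidean_space \<Rightarrow> 'a"
  assumes lin: "linear T" and sa: "\<And>x y. T x \<bullet> y = x \<bullet> T y"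
    and "subspace S" and "\<And>x. x \<in> S \<Longrightarrow> T x \<in> S"
  shows "\<exists>B\<subseteq>S. pairwise orthogonal B \<and> (\<forall>b\<in>B. norm b = 1 \<and> (\<exists>l. T b = l *\<^sub>R b)) \<and> span B = S"
  using assms(3,4)
proof (induction "dim S" arbitrary: S rule: less_induct)
  case less
  show ?case
  proof (cases "\<exists>x\<in>S. x \<noteq> 0")
    case False
    then have "S = {0}" using subspace_0[OF less.prems(1)] by blast
    then show ?thesis by (intro exI[of _ "{}"]) auto
  next
    case True
    obtain v l where v: "v \<in> S" "norm v = 1" "T v = l *\<^sub>R v"
      using selfadjoint_eigenvector[OF lin sa less.prems True] by blast
    have vv: "v \<bullet> v = 1" using v by (simp add: norm_eq_1)
    define S' where "S' = S \<inter> {w. orthogonal v w}"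
    have sub': "subspace S'"
      unfolding S'_def by (intro subspace_inter less.prems subspace_orthogonal_to_vector)
    have "v \<notin> S'" using vv by (simp add: S'_def orthogonal_def)
    then have "S' \<subset> S" using v by (auto simp: S'_def)
    then have "dim S' < dim S"
      using dim_psubset[of S' S] sub' less.prems(1) by (simp add: span_eq_iff[THEN iffD2])
    moreover have "T w \<in> S'" if "w \<in> S'" for w
      using that v less.prems(2) sa[of v w, symmetric] by (auto simp: S'_def orthogonal_def)
    ultimately obtain B where B: "B \<subseteq> S'" "pairwise orthogonal B" "span B = S'"
        "\<forall>b\<in>B. norm b = 1 \<and> (\<exists>l. T b = l *\<^sub>R b)"
      using less.hyps[OF _ sub'] by blast
    have "span (insert v B) = S"
    proof
      show "span (insert v B) \<subseteq> S"
        using B(1) v(1) less.prems(1) by (intro span_minimal) (auto simp: S'_def)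
      show "S \<subseteq> span (insert v B)"
      proof
        fix x assume x: "x \<in> S"
        \<comment> \<open>Removing the component along \<open>v\<close> lands in \<open>S'\<close>,
          which \<open>B\<close> spans.\<close>
        have "x - (v \<bullet> x) *\<^sub>R v \<in> span B"
          using x v vv less.prems(1)
          by (simp add: B(3) S'_def orthogonal_def inner_diff_right subspace_diff subspace_scale)
        then show "x \<in> span (insert v B)" by (auto simp: span_insert)
      qed
    qed
    moreover have "pairwise orthogonal (insert v B)"
      using B(1,2) by (auto simp: pairwise_insert S'_def orthogonal_commute)
    moreover have "insert v B \<subseteq> S" using B(1) v(1) by (auto simp: S'_def)
    ultimately show ?thesis
      using B(4) v by (intro exI[of _ "insert v B"]) auto
  qed
qed

section \<open>Calculus of matrices diagonalised by a given \<open>P\<close>\<close>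

definition diag_mat :: "('n \<Rightarrow> real) \<Rightarrow> real ^ 'n ^ 'n" where
  "diag_mat d = (\<chi> i j. if i = j then d i else 0)"

text \<open>The rows of \<open>P\<close> play the role of eigenvectors and \<open>d\<close> that of
  eigenvalues. For a fixed orthogonal \<open>P\<close>, sums, products and inverses become entrywise
  operations on \<open>d\<close>.\<close>

definition orth_diag :: "real ^ 'n ^ 'n \<Rightarrow> ('n \<Rightarrow> real) \<Rightarrow> real ^ 'n ^ 'n" where
  "orth_diag P d = transpose P ** diag_mat d ** P"

lemma diag_mat_mult: "diag_mat a ** diag_mat b = diag_mat (\<lambda>i. a i * b i)"
  by (simp add: diag_mat_def matrix_matrix_mult_def vec_eq_iff if_distrib[of "\<lambda>x. x * _"]
      sum.delta cong: if_cong)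

lemma transpose_diag_mat [simp]: "transpose (diag_mat d) = diag_mat d"
  by (simp add: diag_mat_def transpose_def vec_eq_iff)

lemma transpose_orth_diag [simp]: "transpose (orth_diag P d) = orth_diag P d"
  by (simp add: orth_diag_def matrix_transpose_mul matrix_mul_assoc)

lemma orth_diag_mult:
  assumes "orthogonal_matrix P"
  shows "orth_diag P a ** orth_diag P b = orth_diag P (\<lambda>i. a i * b i)"
proof -
  have "P ** transpose P = mat 1" using assms by (simp add: orthogonal_matrix_def)
  then have "transpose P ** diag_mat a ** (P ** transpose P) ** diag_mat b ** P
      = transpose P ** (diag_mat a ** diag_mat b) ** P"
    by (simp add: matrix_mul_assoc)
  then have "orth_diag P a ** orth_diag P b = transpose P ** (diag_mat a ** diag_mat b) ** P"
    by (simp add: orth_diag_def matrix_mul_assoc)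
  then show ?thesis by (simp add: diag_mat_mult orth_diag_def)
qed

lemma orth_diag_const:
  fixes P :: "real ^ 'n ^ 'n"
  assumes "orthogonal_matrix P"
  shows "orth_diag P (\<lambda>_. c) = c *\<^sub>R mat 1"
proof -
  have diag: "diag_mat (\<lambda>_. c) = c *\<^sub>R (mat 1 :: real ^ 'n ^ 'n)"
    by (simp add: diag_mat_def mat_def vec_eq_iff)
  show ?thesis
    using assms by (simp add: orth_diag_def diag orthogonal_matrix_def matrix_scalar_ac
        scalar_matrix_assoc[symmetric])
qed

lemma orth_diag_add: "orth_diag P a + orth_diag P b = orth_diag P (\<lambda>i. a i + b i)"
proof -
  have diag: "diag_mat (\<lambda>i. a i + b i) = diag_mat a + diag_mat b"
    by (simp add: diag_mat_def vec_eq_iff)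
  have rdistrib: "(A + B) ** P = A ** P + B ** P" for A B
    by (simp add: matrix_matrix_mult_def vec_eq_iff sum.distrib distrib_right)
  show ?thesis by (simp only: orth_diag_def diag matrix_add_ldistrib rdistrib)
qed

text \<open>Conjugating back by \<open>P\<close> isolates the diagonal. The eigenvalues thus depend
  continuously on \<open>P\<close> and the matrix, and converge as soon as both do.\<close>

lemma orth_diag_entry:
  assumes "orthogonal_matrix P"
  shows "d i = (P ** orth_diag P d ** transpose P) $ i $ i"
proof -
  have "P ** orth_diag P d ** transpose P = diag_mat d"
    using assms unfolding orth_diag_def orthogonal_matrix_def
    by (metis matrix_mul_assoc matrix_mul_lid matrix_mul_rid)
  then show ?thesis by (simp add: diag_mat_def)
qed

lemma orth_diag_eigenvector:
  assumes "orthogonal_matrix P"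
  shows "orth_diag P d *v row i P = d i *\<^sub>R row i P"
proof -
  have PP: "P ** transpose P = mat 1" using assms by (simp add: orthogonal_matrix_def)
  have "transpose P *v axis i 1 = row i P"
    by (simp add: matrix_vector_mul_component vec_eq_iff row_def transpose_def matrix_vector_mult_def
        axis_def if_distrib[of "\<lambda>x. _ * x"] cong: if_cong)
  moreover have "P *v row i P = axis i 1"
    using calculation by (metis PP matrix_vector_mul_assoc matrix_vector_mul_lid)
  moreover have "diag_mat d *v axis i 1 = d i *\<^sub>R axis i 1"
    by (simp add: diag_mat_def matrix_vector_mult_def vec_eq_iff axis_def
        if_distrib[of "\<lambda>x. _ * x"] cong: if_cong)
  ultimately show ?thesis
    unfolding orth_diag_def
    by (metis matrix_vector_mul_assoc matrix_vector_mult_scaleR)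
qed

text \<open>The rows of \<open>P\<close> form an orthonormal eigenbasis. The eigenvector equations
  then read \<open>P ** H = diag_mat d ** P\<close>, and multiplying by \<open>transpose P\<close>
  on the left isolates \<open>H\<close>.\<close>

lemma symmetric_matrix_diagonalization:
  fixes H :: "real ^ 'n ^ 'n"
  assumes "transpose H = H"
  shows "\<exists>P d. orthogonal_matrix P \<and> H = orth_diag P d"
proof -
  have sa: "(H *v x) \<bullet> y = x \<bullet> (H *v y)" for x y
    by (metis assms dot_lmul_matrix vector_transpose_matrix)
  obtain B where B: "pairwise orthogonal B" "span B = UNIV"
      "\<forall>b\<in>B. norm b = 1 \<and> (\<exists>l. H *v b = l *\<^sub>R b)"
    using selfadjoint_orthonormal_eigenbasis[of "\<lambda>x. H *v x" UNIV] sa by auto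
  have "0 \<notin> B" using B(3) by auto
  then have ind: "independent B" using B(1) pairwise_orthogonal_independent by blast
  then have "finite B" "card B = CARD('n)"
    using dim_eq_card[of B UNIV] B(2) finiteI_independent
    by (auto simp: span_UNIV)
  \<comment> \<open>There are as many basis vectors as indices, so the index type itself can number
    the rows.\<close>
  then obtain q where q: "bij_betw q (UNIV :: 'n set) B"
    using finite_same_card_bij[of "UNIV :: 'n set" B] by auto
  then have qB: "q i \<in> B" for i by (auto simp: bij_betw_def)
  have qo: "orthogonal (q i) (q j)" if "i \<noteq> j" for i j
    using B(1) qB[of i] qB[of j] q that unfolding pairwise_def bij_betw_def inj_on_def by blast
  have "\<forall>i. \<exists>l. H *v q i = l *\<^sub>R q i" using B(3) qB by blast
  then obtain d where d: "\<And>i. H *v q i = d i *\<^sub>R q i" using choice by metis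
  define P where "P = (\<chi> i. q i)"
  have row: "row i P = q i" for i by (simp add: P_def row_def)
  have P: "orthogonal_matrix P"
    using B(3) qB qo by (simp add: orthogonal_matrix_orthonormal_rows row)
  have "P ** H = diag_mat d ** P"
  proof -
    have "(P ** H) $ i = (diag_mat d ** P) $ i" for i
    proof -
      have "(P ** H) $ i = q i v* H"
        by (simp add: vec_eq_iff matrix_matrix_mult_def vector_matrix_mult_def P_def mult.commute)
      also have "\<dots> = d i *\<^sub>R q i"
        using d[of i] assms by (metis vector_transpose_matrix)
      also have "\<dots> = (diag_mat d ** P) $ i"
        by (simp add: vec_eq_iff matrix_matrix_mult_def diag_mat_def P_def
            if_distrib[of "\<lambda>x. x * _"] cong: if_cong)
      finally show ?thesis .
    qed
    then show ?thesis by (simp add: vec_eq_iff)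
  qed
  then have "H = orth_diag P d"
    using P unfolding orth_diag_def orthogonal_matrix_def
    by (metis matrix_mul_assoc matrix_mul_lid)
  then show ?thesis using P by blast
qed

section \<open>Inverse and pseudoinverse of a diagonalised matrix\<close>

lemma matrix_inv_eqI:
  fixes A B :: "real ^ 'n ^ 'n"
  assumes "A ** B = mat 1" and "B ** A = mat 1"
  shows "matrix_inv A = B"
proof -
  have "matrix_inv A ** A = mat 1"
    unfolding matrix_inv_def using someI[of "\<lambda>B. A ** B = mat 1 \<and> B ** A = mat 1"] assms by blast
  then show ?thesis using assms(1) by (metis matrix_mul_assoc matrix_mul_lid matrix_mul_rid)
qed

text \<open>Since \<open>A = A ** Y ** A\<close>, the product \<open>A ** X\<close> equals
  \<open>(A ** Y) ** (A ** X)\<close>. Transposing swaps the two symmetric factors, and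
  \<open>A ** X ** A = A\<close> leaves \<open>A ** Y\<close>. The same argument on the other side
  gives \<open>X ** A = Y ** A\<close>, and these two equalities identify \<open>X\<close> and
  \<open>Y\<close>.\<close>

lemma penrose_unique:
  fixes A :: "real ^ 'n ^ 'm"
  assumes X: "A ** X ** A = A" "X ** A ** X = X"
      "transpose (A ** X) = A ** X" "transpose (X ** A) = X ** A"
    and Y: "A ** Y ** A = A" "Y ** A ** Y = Y"
      "transpose (A ** Y) = A ** Y" "transpose (Y ** A) = Y ** A"
  shows "X = Y"
proof -
  have "A ** X = transpose (A ** X)" using X by simp
  also have "\<dots> = transpose ((A ** Y) ** (A ** X))" using Y(1) by (metis matrix_mul_assoc)
  also have "\<dots> = (A ** X) ** (A ** Y)" using X(3) Y(3) by (simp add: matrix_transpose_mul)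
  also have "\<dots> = A ** Y" using X(1) by (metis matrix_mul_assoc)
  finally have AX: "A ** X = A ** Y" .
  have "X ** A = transpose (X ** A)" using X by simp
  also have "\<dots> = transpose ((X ** A) ** (Y ** A))" using Y(1) by (metis matrix_mul_assoc)
  also have "\<dots> = (Y ** A) ** (X ** A)" using X(4) Y(4) by (simp add: matrix_transpose_mul)
  also have "\<dots> = Y ** A" using X(1) by (metis matrix_mul_assoc)
  finally have XA: "X ** A = Y ** A" .
  show ?thesis using X(2) Y(2) AX XA by (metis matrix_mul_assoc)
qed

lemma pinv_eqI:
  assumes "A ** X ** A = A" "X ** A ** X = X"
    "transpose (A ** X) = A ** X" "transpose (X ** A) = X ** A"
  shows "pinv A = X"
  unfolding pinv_def
  by (rule the_equality) (simp_all add: assms penrose_unique[of A _ X])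

text \<open>Division by zero yields zero here, so \<open>inverse (d i)\<close> vanishes on the kernel.\<close>

lemma pinv_orth_diag:
  assumes "orthogonal_matrix P"
  shows "pinv (orth_diag P d) = orth_diag P (\<lambda>i. inverse (d i))"
proof -
  have "(\<lambda>i. d i * inverse (d i) * d i) = d"
    "(\<lambda>i. inverse (d i) * d i * inverse (d i)) = (\<lambda>i. inverse (d i))"
    by (auto simp: fun_eq_iff field_simps)
  then show ?thesis by (intro pinv_eqI) (simp_all only: orth_diag_mult[OF assms] transpose_orth_diag)
qed

lemma matrix_inv_orth_diag:
  assumes "orthogonal_matrix P" and "\<And>i. d i \<noteq> 0"
  shows "matrix_inv (orth_diag P d) = orth_diag P (\<lambda>i. inverse (d i))"
  by (rule matrix_inv_eqI) (simp_all add: orth_diag_mult orth_diag_const assms)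

section \<open>Limits of matrix expressions and of the regularised inverse\<close>

lemma tendsto_matrix_mult [tendsto_intros]:
  fixes A :: "'a \<Rightarrow> real ^ 'n ^ 'm" and B :: "'a \<Rightarrow> real ^ 'p ^ 'n"
  assumes "(A \<longlongrightarrow> a) F" and "(B \<longlongrightarrow> b) F"
  shows "((\<lambda>k. A k ** B k) \<longlongrightarrow> a ** b) F"
  unfolding matrix_matrix_mult_def
  by (intro vec_tendstoI) (auto intro!: tendsto_intros assms)

lemma tendsto_transpose [tendsto_intros]:
  fixes A :: "'a \<Rightarrow> real ^ 'n ^ 'm"
  assumes "(A \<longlongrightarrow> a) F"
  shows "((\<lambda>k. transpose (A k)) \<longlongrightarrow> transpose a) F"
  unfolding transpose_def
  by (intro vec_tendstoI) (auto intro!: tendsto_intros assms)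

lemma tendsto_orth_diag:
  assumes "(P \<longlongrightarrow> p) F" and "\<And>i. ((\<lambda>k. d k i) \<longlongrightarrow> e i) F"
  shows "((\<lambda>k. orth_diag (P k) (d k)) \<longlongrightarrow> orth_diag p e) F"
proof -
  have "((\<lambda>k. diag_mat (d k)) \<longlongrightarrow> diag_mat e) F"
    unfolding diag_mat_def by (intro vec_tendstoI) (auto intro!: assms)
  then show ?thesis unfolding orth_diag_def by (intro tendsto_intros assms)
qed

text \<open>In the eigenbasis the product has entries \<open>d k i / (d k i + \<epsilon> k)\<close>.
  Where \<open>e i\<close> is nonzero they tend to 1, elsewhere \<open>vanish\<close> sends them to
  0. These are exactly the entries \<open>inverse (e i) * e i\<close> of the limit, as
  \<open>inverse 0 = 0\<close>.\<close>

lemma tendsto_matrix_inv_ridge: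
  fixes P :: "nat \<Rightarrow> real ^ 'n ^ 'n"
  assumes orth: "\<And>k. orthogonal_matrix (P k)" "orthogonal_matrix p"
    and lim: "P \<longlonglongrightarrow> p" "\<And>i. (\<lambda>k. d k i) \<longlonglongrightarrow> e i"
    and nonneg: "\<And>k i. 0 \<le> d k i"
    and \<epsilon>: "\<And>k. 0 < \<epsilon> k" "\<epsilon> \<longlonglongrightarrow> 0"
    and vanish: "\<And>i. e i = 0 \<Longrightarrow> (\<lambda>k. d k i / \<epsilon> k) \<longlonglongrightarrow> 0"
  shows "(\<lambda>k. matrix_inv (orth_diag (P k) (d k) + \<epsilon> k *\<^sub>R mat 1) ** orth_diag (P k) (d k))
    \<longlonglongrightarrow> pinv (orth_diag p e) ** orth_diag p e"
proof -
  have pos: "0 < d k i + \<epsilon> k" for k i using nonneg[of k i] \<epsilon>(1)[of k] by linarith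
  \<comment> \<open>The ridge term is itself diagonal in the basis \<open>P k\<close>, with constant
    entry \<open>\<epsilon> k\<close>; positivity of the shifted entries makes the inverse
    entrywise.\<close>
  have "matrix_inv (orth_diag (P k) (d k) + \<epsilon> k *\<^sub>R mat 1) ** orth_diag (P k) (d k)
      = orth_diag (P k) (\<lambda>i. inverse (d k i + \<epsilon> k) * d k i)" for k
    using pos[of k]
    by (subst orth_diag_const[OF orth(1)[of k], symmetric])
      (simp add: orth_diag_add matrix_inv_orth_diag orth less_imp_neq[THEN not_sym] orth_diag_mult)
  moreover have "(\<lambda>k. inverse (d k i + \<epsilon> k) * d k i) \<longlonglongrightarrow> inverse (e i) * e i" for i
  proof (cases "e i = 0")
    case False
    have "(\<lambda>k. inverse (d k i + \<epsilon> k) * d k i) \<longlonglongrightarrow> inverse (e i + 0) * e i"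
      using False by (intro tendsto_intros lim \<epsilon>) auto
    then show ?thesis by simp
  next
    case True
    \<comment> \<open>Numerator and denominator both vanish here; dividing them by
      \<open>\<epsilon> k\<close> exposes the ratio that \<open>vanish\<close> controls.\<close>
    have "(\<lambda>k. inverse (d k i / \<epsilon> k + 1) * (d k i / \<epsilon> k)) \<longlonglongrightarrow> inverse (0 + 1) * 0"
      by (intro tendsto_intros vanish True) auto
    moreover have "inverse (d k i / \<epsilon> k + 1) * (d k i / \<epsilon> k) = inverse (d k i + \<epsilon> k) * d k i" for k
      using pos[of k i] \<epsilon>(1)[of k] by (simp add: field_simps)
    ultimately show ?thesis using True by simp
  qed
  ultimately show ?thesis
    by (simp add: pinv_orth_diag orth orth_diag_mult tendsto_orth_diag lim)
qed

section \<open>Ordered eigenvalues\<close>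

lemma poly_charpoly: "poly (charpoly H) l = det (l *\<^sub>R mat 1 - H)"
proof -
  have "poly (charpoly H) l = det (\<chi> i j. poly ((\<chi> i j. (if i = j then [:0, 1:] else 0) - [:H $ i $ j:]) $ i $ j) l)"
    unfolding charpoly_def det_def by (simp add: poly_sum poly_prod poly_of_int)
  also have "(\<chi> i j. poly ((\<chi> i j. (if i = j then [:0, 1:] else 0) - [:H $ i $ j:]) $ i $ j) l)
      = l *\<^sub>R mat 1 - H"
    by (simp add: vec_eq_iff mat_def)
  finally show ?thesis .
qed

lemma poly_charpoly_eq_0_iff: "poly (charpoly H) l = 0 \<longleftrightarrow> l \<in> spec H"
proof -
  have "poly (charpoly H) l = 0 \<longleftrightarrow> \<not> invertible (l *\<^sub>R mat 1 - H)"
    by (simp add: poly_charpoly invertible_det_nz)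
  also have "\<dots> \<longleftrightarrow> (\<exists>x. x \<noteq> 0 \<and> (l *\<^sub>R mat 1 - H) *v x = 0)"
    by (metis invertible_left_inverse matrix_left_invertible_ker)
  also have "\<dots> \<longleftrightarrow> l \<in> spec H"
    by (auto simp: spec_def matrix_vector_mult_diff_rdistrib scaleR_matrix_vector_assoc[symmetric]
        intro: sym)
  finally show ?thesis .
qed

text \<open>No eigenvalue exceeds the operator norm, so the polynomial does not vanish at the
  operator norm plus 1. Being nonzero, it has as members of \<open>proots\<close> precisely its
  roots.\<close>

lemma charpoly_nz: "charpoly H \<noteq> 0"
proof -
  let ?l = "onorm (\<lambda>v. H *v v) + 1"
  have bl: "bounded_linear (\<lambda>v. H *v v)" by (simp add: matrix_vector_mul_bounded_linear)
  have "?l \<notin> spec H"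
  proof
    assume "?l \<in> spec H"
    then obtain v where v: "v \<noteq> 0" "H *v v = ?l *\<^sub>R v" by (auto simp: spec_def)
    have "norm (?l *\<^sub>R v) \<le> onorm (\<lambda>v. H *v v) * norm v"
      using onorm[OF bl, of v] v by simp
    then have "?l * norm v \<le> onorm (\<lambda>v. H *v v) * norm v"
      using onorm_pos_le[OF bl] by simp
    then show False using v(1) by (simp add: algebra_simps)
  qed
  then have "poly (charpoly H) ?l \<noteq> 0" by (simp add: poly_charpoly_eq_0_iff)
  then show ?thesis by auto
qed

text \<open>Each term of the Leibniz expansion is a product of n entries of degree at most 1. This
  bounds the number of roots counted with multiplicity.\<close>

lemma degree_charpoly_le: "degree (charpoly (H :: real ^ 'n ^ 'n)) \<le> CARD('n)"
proof -
  let ?M = "\<chi> i j. (if i = j then [:0, 1:] else 0) - [:H $ i $ j:]"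
  have deg1: "degree (?M $ i $ j) \<le> 1" for i j
    by (simp add: degree_diff_le)
  have "degree (of_int (sign p) * (\<Prod>i\<in>UNIV. ?M $ i $ p i)) \<le> CARD('n)" for p :: "'n \<Rightarrow> 'n"
  proof -
    have "degree (\<Prod>i\<in>UNIV. ?M $ i $ p i) \<le> (\<Sum>i\<in>(UNIV::'n set). 1)"
      by (rule order_trans[OF degree_prod_sum_le]) (auto simp del: sum_constant intro!: sum_mono deg1[simplified])
    then show ?thesis
      by (intro order_trans[OF degree_mult_le]) (simp add: sign_def)
  qed
  then show ?thesis
    unfolding charpoly_def det_def by (intro degree_sum_le) auto
qed

lemma spec_imp_eig:
  fixes H :: "real ^ 'n ^ 'n"
  assumes "l \<in> spec H"
  shows "\<exists>j\<in>{1..CARD('n)}. eig H j = l"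
proof -
  define xs where "xs = rev (sorted_list_of_multiset (proots (charpoly H)))"
  have "l \<in># proots (charpoly H)"
    using assms by (simp add: charpoly_nz poly_charpoly_eq_0_iff)
  then have "l \<in> set xs" by (simp add: xs_def)
  then obtain i where i: "i < length xs" "xs ! i = l" by (auto simp: in_set_conv_nth)
  have "length xs = size (proots (charpoly H))"
    unfolding xs_def by (metis length_rev mset_sorted_list_of_multiset size_mset)
  then have "length xs \<le> CARD('n)"
    using size_proots_le[of "charpoly H"] degree_charpoly_le[of H] by linarith
  \<comment> \<open>List positions start at 0 and \<open>eig\<close> counts from 1, hence the shift
    to \<open>Suc i\<close>.\<close>
  then show ?thesis
    using i by (intro bexI[of _ "Suc i"]) (auto simp: eig_def xs_def)
qed


lemma orth_diag_imp_spec: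
  assumes "orthogonal_matrix P"
  shows "d i \<in> spec (orth_diag P d)"
proof -
  have "norm (row i P) = 1"
    using assms by (simp add: orthogonal_matrix_orthonormal_rows)
  then have "row i P \<noteq> 0" by auto
  then show ?thesis using orth_diag_eigenvector[OF assms] by (auto simp: spec_def)
qed

lemma spec_symmetric_psd_nonneg:
  assumes "symmetric_psd H" and "l \<in> spec H"
  shows "0 \<le> l"
proof -
  obtain v where v: "v \<noteq> 0" "H *v v = l *\<^sub>R v" using assms(2) by (auto simp: spec_def)
  have "0 \<le> v \<bullet> (H *v v)" using assms(1) by (simp add: symmetric_psd_def)
  then show ?thesis using v inner_gt_zero_iff[of v] by (auto simp del: inner_gt_zero_iff simp: zero_le_mult_iff)
qed

section \<open>Vanishing eigenvalues\<close>

text \<open>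
  The position of \<open>d k i\<close> in the ordered spectrum may depend on \<open>k\<close>. There are finitely many
  possible positions, so it is constant along a subsequence.
\<close>

lemma spec_eq_eig_subseq:
  fixes H :: "nat \<Rightarrow> real ^ 'n ^ 'n" and d :: "nat \<Rightarrow> 'n \<Rightarrow> real"
  assumes "\<And>k i. d k i \<in> spec (H k)"
  shows "\<exists>r p. strict_mono (r :: nat \<Rightarrow> nat) \<and>
    (\<forall>i. p i \<in> {1..CARD('n)} \<and> (\<forall>k. d (r k) i = eig (H (r k)) (p i)))"
proof -
  have "\<forall>k i. \<exists>j. j \<in> {1..CARD('n)} \<and> eig (H k) j = d k i" using spec_imp_eig[OF assms] by blast
  then obtain pos where pos: "\<And>k i. pos k i \<in> {1..CARD('n)}" "\<And>k i. eig (H k) (pos k i) = d k i"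
    by metis
  have "range pos \<subseteq> (\<Pi>\<^sub>E i\<in>UNIV. {1..CARD('n)})" using pos(1) by auto
  then have "finite (range pos)" by (rule finite_subset) (simp add: finite_PiE)
  then obtain k0 where "infinite {k. pos k = pos k0}"
    using pigeonhole_infinite[of UNIV pos] by auto
  then obtain r :: "nat \<Rightarrow> nat" where r: "strict_mono r" "\<And>k. pos (r k) = pos k0"
    using infinite_enumerate by blast
  then show ?thesis using pos by (intro exI[of _ r] exI[of _ "pos k0"]) metis
qed

lemma decreases_to_zero_subseq:
  assumes "decreases_to_zero \<epsilon>" and "strict_mono r"
  shows "decreases_to_zero (\<lambda>k. \<epsilon> (r k))"
proof -
  have \<epsilon>: "\<And>k. 0 < \<epsilon> k" "decseq \<epsilon>" "\<epsilon> \<longlonglongrightarrow> 0"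
    using assms(1) by (simp_all add: decreases_to_zero_def)
  have "decseq (\<lambda>k. \<epsilon> (r k))"
    using \<epsilon>(2) assms(2) unfolding decseq_def by (metis strict_mono_less_eq)
  moreover have "(\<lambda>k. \<epsilon> (r k)) \<longlonglongrightarrow> 0"
    using LIMSEQ_subseq_LIMSEQ[OF \<epsilon>(3) assms(2)] by (simp add: comp_def)
  ultimately show ?thesis using \<epsilon>(1) by (simp add: decreases_to_zero_def)
qed

text \<open>Under the spectral gap a small eigenvalue must be exactly 0. Under fast vanishing the
  decay is known only for a fixed position in the ordered spectrum, so the sequence is first thinned
  until each \<open>d k i\<close> keeps its position.\<close>

lemma vanishing_eigenvalues_subseq:
  fixes f :: "real ^ 'n \<Rightarrow> real ^ 'm \<Rightarrow> real"
    and JF :: "real ^ ('n + 'm) \<Rightarrow> (real ^ ('n + 'm) ^ 'n) set"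
    and d :: "nat \<Rightarrow> 'n \<Rightarrow> real"
  assumes hyp: "spectral_gap f JF eb \<theta> \<or> fast_vanishing f JF eb \<theta>"
    and \<epsilon>: "decreases_to_zero \<epsilon>" "\<And>k. \<epsilon> k \<le> eb"
    and As: "\<And>k. As k \<in> JF (vjoin (x_eps f (\<epsilon> k) \<theta>) \<theta>)" "convergent (\<lambda>k. Hblock (As k))"
    and d: "\<And>k i. d k i \<in> spec (Hblock (As k))" "\<And>i. (\<lambda>k. d k i) \<longlonglongrightarrow> e i"
  shows "\<exists>r. strict_mono r \<and> (\<forall>i. e i = 0 \<longrightarrow> (\<lambda>k. d (r k) i / \<epsilon> (r k)) \<longlonglongrightarrow> 0)"
  using hyp
proof
  assume "spectral_gap f JF eb \<theta>"
  then obtain l eG where l: "l > 0" "eG > 0"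
    and gap: "\<And>\<epsilon> A. 0 < \<epsilon> \<Longrightarrow> \<epsilon> \<le> eG \<Longrightarrow> A \<in> JF (vjoin (x_eps f \<epsilon> \<theta>) \<theta>)
      \<Longrightarrow> spec (Hblock A) \<subseteq> {0} \<union> {l..}"
    unfolding spectral_gap_def by blast
  have "(\<lambda>k. d k i / \<epsilon> k) \<longlonglongrightarrow> 0" if "e i = 0" for i
  proof -
    have "\<forall>\<^sub>F k in sequentially. \<epsilon> k < eG"
      using \<epsilon>(1) l(2) by (auto simp: decreases_to_zero_def intro: order_tendstoD)
    moreover have "\<forall>\<^sub>F k in sequentially. d k i < l"
      using d(2)[of i] that l(1) by (auto intro: order_tendstoD)
    \<comment> \<open>Once \<open>\<epsilon> k < eG\<close> and \<open>d k i < l\<close>, the gap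
      leaves 0 as the only possible value.\<close>
    ultimately have "\<forall>\<^sub>F k in sequentially. d k i / \<epsilon> k = 0"
    proof eventually_elim
      case (elim k)
      then have "d k i \<in> {0} \<union> {l..}"
        using gap[of "\<epsilon> k" "As k"] As(1)[of k] \<epsilon>(1) d(1)[of k i]
        by (auto simp: decreases_to_zero_def)
      then show ?case using elim by auto
    qed
    then show ?thesis by (rule tendsto_eventually)
  qed
  then show ?thesis by (intro exI[of _ id]) (auto simp: strict_mono_def)
next
  assume fv: "fast_vanishing f JF eb \<theta>"
  obtain r p where r: "strict_mono (r :: nat \<Rightarrow> nat)"
    and p: "\<And>i. p i \<in> {1..CARD('n)}" "\<And>i k. d (r k) i = eig (Hblock (As (r k))) (p i)"
    using spec_eq_eig_subseq[of d "\<lambda>k. Hblock (As k)", OF d(1)] by blast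
  have conv: "convergent (\<lambda>k. Hblock (As (r k)))"
    using convergent_subseq_convergent[OF As(2) r] by (simp add: comp_def)
  have "(\<lambda>k. d (r k) i / \<epsilon> (r k)) \<longlonglongrightarrow> 0" if "e i = 0" for i
  proof -
    have "(\<lambda>k. d (r k) i) \<longlonglongrightarrow> 0"
      using LIMSEQ_subseq_LIMSEQ[OF d(2) r, of i] that by (simp add: comp_def)
    \<comment> \<open>Fast vanishing is applied to the thinned sequence, since only along
      \<open>r\<close> is the eigenvalue at position \<open>p i\<close> known to tend to 0.\<close>
    then have "(\<lambda>k. d (r k) i) \<in> o(\<lambda>k. \<epsilon> (r k))"
      using fv decreases_to_zero_subseq[OF \<epsilon>(1) r] \<epsilon>(2) As(1) conv p
      unfolding fast_vanishing_def by simp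
    then show ?thesis by (rule smalloD_tendsto)
  qed
  then show ?thesis using r by blast
qed

section \<open>Tikhonov regularisation\<close>

text \<open>Outside the ball of radius \<open>norm s\<close> neither summand is smaller than at
  \<open>s\<close>, so a minimiser over this compact ball is a global one.\<close>

lemma tikhonov_minimizer_exists:
  fixes g :: "'a::euclidean_space \<Rightarrow> real"
  assumes cont: "continuous_on UNIV g" and s: "\<And>y. g s \<le> g y" and "0 < \<epsilon>"
  shows "\<exists>x. is_arg_min (\<lambda>x. g x + \<epsilon> / 2 * (norm x)\<^sup>2) (\<lambda>_. True) x"
proof -
  let ?h = "\<lambda>x. g x + \<epsilon> / 2 * (norm x)\<^sup>2"
  have "continuous_on (cball 0 (norm s)) ?h"
    by (intro continuous_intros continuous_on_subset[OF cont]) auto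
  moreover have "cball 0 (norm s) \<noteq> {}" by auto
  ultimately obtain x where x: "\<And>y. y \<in> cball 0 (norm s) \<Longrightarrow> ?h x \<le> ?h y"
    using continuous_attains_inf[of "cball 0 (norm s)" ?h] compact_cball by blast
  have "?h x \<le> ?h y" for y
  proof (cases "norm y \<le> norm s")
    case False
    have "?h x \<le> ?h s" by (rule x) simp
    also have "\<dots> \<le> ?h y"
      using s[of y] False \<open>0 < \<epsilon>\<close> by (intro add_mono mult_left_mono power_mono) auto
    finally show ?thesis .
  next
    case True
    then show ?thesis by (intro x) simp
  qed
  then show ?thesis by (auto simp: is_arg_min_linorder)
qed

lemma norm_minimizer:
  assumes "closed S" and "S \<noteq> {}"
  shows "is_arg_min norm (\<lambda>x. x \<in> S) (arg_min_on norm (S :: 'a::euclidean_space set))"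
proof -
  obtain x where "x \<in> S" "\<And>y. y \<in> S \<Longrightarrow> dist 0 x \<le> dist 0 y"
    using distance_attains_inf[OF assms] by blast
  then have "is_arg_min norm (\<lambda>x. x \<in> S) x" by (auto simp: is_arg_min_linorder)
  then show ?thesis unfolding arg_min_on_def arg_min_def by (rule someI)
qed

text \<open>Otherwise infinitely many terms keep a distance \<open>e\<close> from \<open>L\<close>,
  and by compactness they have a cluster point different from \<open>L\<close>.\<close>

lemma bounded_tendstoI:
  fixes X :: "nat \<Rightarrow> 'a::heine_borel"
  assumes bdd: "bounded (range X)"
    and cluster: "\<And>r z. strict_mono r \<Longrightarrow> (X \<circ> r) \<longlonglongrightarrow> z \<Longrightarrow> z = L"
  shows "X \<longlonglongrightarrow> L"
proof (rule ccontr)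
  assume "\<not> X \<longlonglongrightarrow> L"
  then obtain e where e: "e > 0" and "\<forall>N. \<exists>n\<ge>N. e \<le> dist (X n) L"
    by (auto simp: lim_sequentially not_less)
  then have "infinite {n. e \<le> dist (X n) L}"
    by (auto simp: infinite_nat_iff_unbounded_le)
  then obtain r :: "nat \<Rightarrow> nat" where r: "strict_mono r" "\<And>n. e \<le> dist (X (r n)) L"
    using infinite_enumerate by blast
  have "bounded (range (X \<circ> r))" by (rule bounded_subset[OF bdd]) auto
  then obtain z r' where r': "strict_mono (r' :: nat \<Rightarrow> nat)" "((X \<circ> r) \<circ> r') \<longlonglongrightarrow> z"
    using bounded_imp_convergent_subsequence by blast
  then have "z = L"
    using cluster[of "r \<circ> r'"] r(1) by (simp add: strict_mono_o comp_assoc)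
  with r'(2) have "(\<lambda>n. X (r (r' n))) \<longlonglongrightarrow> L" by (simp add: comp_def)
  then obtain n where "dist (X (r (r' n))) L < e"
    using e by (auto simp: lim_sequentially)
  then show False using r(2)[of "r' n"] by simp
qed

text \<open>Comparing values at \<open>X k\<close> and at the minimal norm solution
  \<open>xm\<close> gives \<open>norm (X k) \<le> norm xm\<close> and shows that
  \<open>f (X k) \<theta>\<close> approaches the minimum. Every cluster point is therefore a
  solution of norm at most \<open>norm xm\<close>, hence equal to \<open>xm\<close>.\<close>

lemma x_eps_tendsto_x_min:
  fixes f :: "real ^ 'n \<Rightarrow> real ^ 'm \<Rightarrow> real"
  assumes cont: "continuous_on UNIV (\<lambda>x. f x \<theta>)" and conv: "convex_on UNIV (\<lambda>x. f x \<theta>)"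
    and ne: "solutions f \<theta> \<noteq> {}" and \<epsilon>: "\<And>k. 0 < \<epsilon> k" "\<epsilon> \<longlonglongrightarrow> 0"
  shows "(\<lambda>k. x_eps f (\<epsilon> k) \<theta>) \<longlonglongrightarrow> x_min f \<theta>"
proof -
  obtain s where "s \<in> solutions f \<theta>" using ne by blast
  then have s: "f s \<theta> \<le> f y \<theta>" for y by (simp add: solutions_def is_arg_min_linorder)
  \<comment> \<open>As a sublevel set, the solution set inherits closedness from continuity and
    convexity from \<open>conv\<close>.\<close>
  have S: "solutions f \<theta> = {x. f x \<theta> \<le> f s \<theta>}"
    using s by (auto simp: solutions_def is_arg_min_linorder intro: order_trans)
  have clS: "closed (solutions f \<theta>)"
    unfolding S by (intro closed_Collect_le cont continuous_intros)
  have convS: "convex (solutions f \<theta>)"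
  proof (unfold S, intro convexI, unfold mem_Collect_eq)
    fix x y u v assume "f x \<theta> \<le> f s \<theta>" "f y \<theta> \<le> f s \<theta>" "0 \<le> u" "0 \<le> v" "u + v = (1::real)"
    then show "f (u *\<^sub>R x + v *\<^sub>R y) \<theta> \<le> f s \<theta>"
      using convex_lower[OF conv, of x y u v] by simp
  qed
  define xm where "xm = x_min f \<theta>"
  have "is_arg_min norm (\<lambda>x. x \<in> solutions f \<theta>) xm"
    unfolding xm_def x_min_def by (rule norm_minimizer[OF clS ne])
  then have xm: "xm \<in> solutions f \<theta>" "\<And>y. y \<in> solutions f \<theta> \<Longrightarrow> norm xm \<le> norm y"
    by (auto simp: is_arg_min_linorder)
  have fxm: "f xm \<theta> = f s \<theta>" using xm(1) s[of xm] by (simp add: S)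
  define X where "X k = x_eps f (\<epsilon> k) \<theta>" for k
  have opt: "f (X k) \<theta> + \<epsilon> k / 2 * (norm (X k))\<^sup>2 \<le> f y \<theta> + \<epsilon> k / 2 * (norm y)\<^sup>2" for k y
  proof -
    have "is_arg_min (\<lambda>x. f x \<theta> + \<epsilon> k / 2 * (norm x)\<^sup>2) (\<lambda>_. True) (X k)"
      unfolding X_def x_eps_def arg_min_def
      by (rule someI_ex) (rule tikhonov_minimizer_exists[OF cont s \<epsilon>(1)])
    then show ?thesis by (simp add: is_arg_min_linorder)
  qed
  have nX: "norm (X k) \<le> norm xm" for k
  proof -
    have "\<epsilon> k / 2 * (norm (X k))\<^sup>2 \<le> \<epsilon> k / 2 * (norm xm)\<^sup>2"
      using opt[of k xm] s[of "X k"] fxm by linarith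
    then have "(norm (X k))\<^sup>2 \<le> (norm xm)\<^sup>2" using \<epsilon>(1)[of k] by simp
    then show ?thesis by (rule power2_le_imp_le) simp
  qed
  have fX: "f (X k) \<theta> \<le> f s \<theta> + \<epsilon> k / 2 * (norm xm)\<^sup>2" for k
  proof -
    have "0 \<le> \<epsilon> k / 2 * (norm (X k))\<^sup>2" using \<epsilon>(1)[of k] by simp
    then show ?thesis using opt[of k xm] fxm by linarith
  qed
  have "X \<longlonglongrightarrow> xm"
  proof (rule bounded_tendstoI)
    show "bounded (range X)" using nX by (auto simp: bounded_iff)
    fix r :: "nat \<Rightarrow> nat" and z assume r: "strict_mono r" and z: "(X \<circ> r) \<longlonglongrightarrow> z"
    have "norm z \<le> norm xm"
      by (rule LIMSEQ_le_const2[OF tendsto_norm[OF z]]) (simp add: nX)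
    have "(\<lambda>k. f ((X \<circ> r) k) \<theta>) \<longlonglongrightarrow> f z \<theta>"
      by (rule continuous_on_tendsto_compose[OF cont z]) auto
    moreover have "(\<lambda>k. f s \<theta> + (\<epsilon> \<circ> r) k / 2 * (norm xm)\<^sup>2) \<longlonglongrightarrow> f s \<theta> + 0 / 2 * (norm xm)\<^sup>2"
      by (intro tendsto_intros LIMSEQ_subseq_LIMSEQ[OF \<epsilon>(2) r]) auto
    ultimately have "f z \<theta> \<le> f s \<theta> + 0 / 2 * (norm xm)\<^sup>2"
      by (rule LIMSEQ_le) (use fX in simp)
    then have "f z \<theta> \<le> f s \<theta>" by simp
    then have "z \<in> solutions f \<theta>" by (simp add: S)
    \<comment> \<open>A closed convex set has a single point closest to 0.\<close>
    then show "z = xm"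
      using any_closest_point_unique[OF convS clS, of z xm 0] xm \<open>norm z \<le> norm xm\<close>
      by (auto intro: order_trans)
  qed
  then show ?thesis by (simp add: X_def[abs_def] xm_def)
qed

section \<open>Convergence of the regularised Jacobians\<close>

lemma norm_matrix_le:
  fixes A :: "real ^ 'n ^ 'm"
  assumes "\<And>i j. \<bar>A $ i $ j\<bar> \<le> c"
  shows "norm A \<le> of_nat CARD('m) * (of_nat CARD('n) * c)"
proof -
  have "norm (A $ i) \<le> of_nat CARD('n) * c" for i
    by (rule order_trans[OF norm_le_l1_cart]) (rule sum_bounded_above, rule assms)
  then have "(\<Sum>i\<in>UNIV. norm (A $ i)) \<le> of_nat CARD('m) * (of_nat CARD('n) * c)"
    by (intro sum_bounded_above)
  moreover have "norm A \<le> (\<Sum>i\<in>UNIV. norm (A $ i))"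
    unfolding norm_vec_def by (rule L2_set_le_sum) simp
  ultimately show ?thesis by linarith
qed

text \<open>The rows are unit vectors, so every entry is at most 1 in absolute value.\<close>

lemma bounded_orthogonal_matrices: "bounded {P :: real ^ 'n ^ 'n. orthogonal_matrix P}"
proof -
  have "\<bar>P $ i $ j\<bar> \<le> 1" if "orthogonal_matrix P" for P :: "real ^ 'n ^ 'n" and i j
  proof -
    have "norm (P $ i) = 1"
      using that by (simp add: orthogonal_matrix_orthonormal_rows row_def)
    then show ?thesis using component_le_norm_cart[of "P $ i" j] by simp
  qed
  then show ?thesis unfolding bounded_iff using norm_matrix_le by blast
qed

lemma orthogonal_matrix_limit:
  fixes P :: "nat \<Rightarrow> real ^ 'n ^ 'n"
  assumes "\<And>k. orthogonal_matrix (P k)" and "P \<longlonglongrightarrow> p"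
  shows "orthogonal_matrix p"
proof -
  have "(\<lambda>k. transpose (P k) ** P k) \<longlonglongrightarrow> transpose p ** p"
    by (intro tendsto_intros assms)
  then show ?thesis
    using assms(1) by (simp add: orthogonal_matrix LIMSEQ_const_iff)
qed

lemma tendsto_Hblock:
  assumes "(A \<longlongrightarrow> a) F"
  shows "((\<lambda>k. Hblock (A k)) \<longlongrightarrow> Hblock a) F"
  unfolding Hblock_def xpart_def by (intro vec_tendstoI) (auto intro!: tendsto_intros assms)

lemma tendsto_Mblock:
  assumes "(A \<longlongrightarrow> a) F"
  shows "((\<lambda>k. Mblock (A k)) \<longlongrightarrow> Mblock a) F"
  unfolding Mblock_def tpart_def by (intro vec_tendstoI) (auto intro!: tendsto_intros assms)

text \<open>Orthogonal matrices and the factors \<open>W k\<close> stay bounded, so both converge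
  along a subsequence, and the eigenvalues follow. A further subsequence provides the decay that
  \<open>tendsto_matrix_inv_ridge\<close> asks for.\<close>

lemma regularised_jacobian_subseq_limit:
  fixes f :: "real ^ 'n \<Rightarrow> real ^ 'm \<Rightarrow> real"
    and JF :: "real ^ ('n + 'm) \<Rightarrow> (real ^ ('n + 'm) ^ 'n) set"
  assumes hyp: "spectral_gap f JF eb \<theta> \<or> fast_vanishing f JF eb \<theta>"
    and range: "uniform_range_condition f JF Om eb" and "\<theta> \<in> Om"
    and \<epsilon>: "decreases_to_zero \<epsilon>" "\<And>k. \<epsilon> k \<le> eb"
    and As: "\<And>k. As k \<in> JF (vjoin (x_eps f (\<epsilon> k) \<theta>) \<theta>)" "As \<longlonglongrightarrow> A"
  shows "\<exists>r. strict_mono r \<and>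
    (\<lambda>k. matrix_inv (Hblock (As (r k)) + \<epsilon> (r k) *\<^sub>R mat 1) ** Mblock (As (r k)))
      \<longlonglongrightarrow> pinv (Hblock A) ** Mblock A"
proof -
  have \<epsilon>pos: "0 < \<epsilon> k" for k using \<epsilon>(1) by (simp add: decreases_to_zero_def)
  define H where "H k = Hblock (As k)" for k
  have limH: "H \<longlonglongrightarrow> Hblock A" unfolding H_def by (rule tendsto_Hblock[OF As(2)])
  \<comment> \<open>The parameter is fixed, so the range condition is used on the compact set
    \<open>{\<theta>}\<close>; its constant is uniform in the regularisation.\<close>
  obtain C where C: "\<And>\<epsilon> B. 0 < \<epsilon> \<Longrightarrow> \<epsilon> \<le> eb \<Longrightarrow> B \<in> JF (vjoin (x_eps f \<epsilon> \<theta>) \<theta>) \<Longrightarrow>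
      symmetric_psd (Hblock B) \<and> (\<exists>W. Mblock B = Hblock B ** W \<and> onorm (\<lambda>v. W *v v) \<le> C)"
    using range[unfolded uniform_range_condition_def, rule_format, of "{\<theta>}"] \<open>\<theta> \<in> Om\<close> by auto
  have psd: "symmetric_psd (H k)" for k using C[OF \<epsilon>pos \<epsilon>(2) As(1)] by (simp add: H_def)
  have "\<forall>k. \<exists>W. Mblock (As k) = H k ** W \<and> onorm (\<lambda>v. W *v v) \<le> C"
    using C[OF \<epsilon>pos \<epsilon>(2) As(1)] by (simp add: H_def)
  from choice[OF this] obtain W
    where "\<forall>k. Mblock (As k) = H k ** W k \<and> onorm (\<lambda>v. W k *v v) \<le> C" ..
  then have W: "Mblock (As k) = H k ** W k" "onorm (\<lambda>v. W k *v v) \<le> C" for k by simp_all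
  have "\<forall>k. \<exists>Q. orthogonal_matrix (fst Q) \<and> H k = orth_diag (fst Q) (snd Q)"
    using symmetric_matrix_diagonalization[of "H _"] psd by (simp add: symmetric_psd_def)
  from choice[OF this] obtain Q
    where Q: "\<forall>k. orthogonal_matrix (fst (Q k)) \<and> H k = orth_diag (fst (Q k)) (snd (Q k))" ..
  define P where "P k = fst (Q k)" for k
  define d where "d k = snd (Q k)" for k
  have P: "orthogonal_matrix (P k)" and Hd: "H k = orth_diag (P k) (d k)" for k
    using Q[rule_format, of k] by (simp_all add: P_def d_def)
  have "\<bar>W k $ i $ j\<bar> \<le> C" for k i j
    by (rule order_trans[OF matrix_component_le_onorm W(2)])
  then have "norm (W k) \<le> of_nat CARD('n) * (of_nat CARD('m) * C)" for k
    by (rule norm_matrix_le)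
  then have "bounded (range W)" unfolding bounded_iff by blast
  moreover have "bounded (range P)"
    using bounded_orthogonal_matrices by (rule bounded_subset) (auto simp: P)
  ultimately have "bounded (range P \<times> range W)" by (simp add: bounded_Times)
  then have "bounded (range (\<lambda>k. (P k, W k)))" by (rule bounded_subset) auto
  \<comment> \<open>One extraction on pairs serves \<open>P\<close> and \<open>W\<close>
    together.\<close>
  then obtain r1 pw where r1: "strict_mono (r1 :: nat \<Rightarrow> nat)" "((\<lambda>k. (P k, W k)) \<circ> r1) \<longlonglongrightarrow> pw"
    using bounded_imp_convergent_subsequence by blast
  define p where "p = fst pw"
  define w where "w = snd pw"
  have limP: "(\<lambda>k. P (r1 k)) \<longlonglongrightarrow> p" and limW: "(\<lambda>k. W (r1 k)) \<longlonglongrightarrow> w"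
    using tendsto_fst[OF r1(2)] tendsto_snd[OF r1(2)] by (simp_all add: comp_def p_def w_def)
  have p: "orthogonal_matrix p" using P limP by (rule orthogonal_matrix_limit)
  have limH1: "(\<lambda>k. H (r1 k)) \<longlonglongrightarrow> Hblock A"
    using LIMSEQ_subseq_LIMSEQ[OF limH r1(1)] by (simp add: comp_def)
  \<comment> \<open>The limits of the eigenvalues, read off by the formula of
    \<open>orth_diag_entry\<close> at the limit matrices.\<close>
  define e where "e i = (p ** Hblock A ** transpose p) $ i $ i" for i
  have limd: "(\<lambda>k. d (r1 k) i) \<longlonglongrightarrow> e i" for i
  proof -
    have "d k i = (P k ** H k ** transpose (P k)) $ i $ i" for k
      unfolding Hd by (rule orth_diag_entry[OF P])
    then show ?thesis unfolding e_def by (simp only:) (intro tendsto_intros limP limH1)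
  qed
  have HA: "Hblock A = orth_diag p e"
    by (rule LIMSEQ_unique[OF limH1[unfolded Hd] tendsto_orth_diag[OF limP limd]])
  have spec: "d k i \<in> spec (H k)" for k i unfolding Hd by (rule orth_diag_imp_spec[OF P])
  have "convergent (\<lambda>k. Hblock (As (r1 k)))"
    using limH1 unfolding H_def by (rule convergentI)
  from vanishing_eigenvalues_subseq[where d = "\<lambda>k. d (r1 k)" and e = e, OF hyp
      decreases_to_zero_subseq[OF \<epsilon>(1) r1(1)] \<epsilon>(2) As(1) this spec[unfolded H_def] limd]
  obtain r2 where r2: "strict_mono r2"
      and van: "\<And>i. e i = 0 \<Longrightarrow> (\<lambda>k. d (r1 (r2 k)) i / \<epsilon> (r1 (r2 k))) \<longlonglongrightarrow> 0"
    by auto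
  define r where "r k = r1 (r2 k)" for k
  have r: "strict_mono r" using r1(1) r2 by (simp add: r_def strict_mono_def)
  have limr: "(\<lambda>k. P (r k)) \<longlonglongrightarrow> p" "(\<lambda>k. d (r k) i) \<longlonglongrightarrow> e i" "(\<lambda>k. W (r k)) \<longlonglongrightarrow> w" for i
    unfolding r_def
    using limP[THEN LIMSEQ_subseq_LIMSEQ, OF r2] limd[THEN LIMSEQ_subseq_LIMSEQ, OF r2]
      limW[THEN LIMSEQ_subseq_LIMSEQ, OF r2] by (simp_all add: comp_def)
  have "(\<lambda>k. matrix_inv (orth_diag (P (r k)) (d (r k)) + \<epsilon> (r k) *\<^sub>R mat 1) ** orth_diag (P (r k)) (d (r k)))
      \<longlonglongrightarrow> pinv (orth_diag p e) ** orth_diag p e"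
  proof (rule tendsto_matrix_inv_ridge)
    show "(\<lambda>k. \<epsilon> (r k)) \<longlonglongrightarrow> 0"
      using decreases_to_zero_subseq[OF \<epsilon>(1) r] by (simp add: decreases_to_zero_def)
    show "0 \<le> d (r k) i" for k i using spec_symmetric_psd_nonneg[OF psd spec] .
    show "(\<lambda>k. d (r k) i / \<epsilon> (r k)) \<longlonglongrightarrow> 0" if "e i = 0" for i using van[OF that] by (simp add: r_def)
  qed (rule P p limr \<epsilon>pos)+
  then have "(\<lambda>k. matrix_inv (H (r k) + \<epsilon> (r k) *\<^sub>R mat 1) ** H (r k) ** W (r k))
      \<longlonglongrightarrow> pinv (Hblock A) ** Hblock A ** w"
    unfolding Hd[symmetric] HA[symmetric] by (rule tendsto_matrix_mult[OF _ limr(3)])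
  \<comment> \<open>Passing to the limit in \<open>Mblock (As k) = H k ** W k\<close> identifies
    \<open>Hblock A ** w\<close>, which turns the projector applied to \<open>w\<close> into
    \<open>pinv (Hblock A) ** Mblock A\<close>.\<close>
  moreover have "Mblock A = Hblock A ** w"
  proof (rule LIMSEQ_unique)
    show "(\<lambda>k. Mblock (As (r1 k))) \<longlonglongrightarrow> Mblock A"
      using LIMSEQ_subseq_LIMSEQ[OF tendsto_Mblock[OF As(2)] r1(1)] by (simp add: comp_def)
    show "(\<lambda>k. Mblock (As (r1 k))) \<longlonglongrightarrow> Hblock A ** w"
      unfolding W(1) by (intro tendsto_intros limH1 limW)
  qed
  ultimately show ?thesis
    using r unfolding W(1) H_def by (intro exI[of _ r]) (simp add: matrix_mul_assoc)
qed

section \<open>The inclusion at a fixed parameter\<close>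

theorem theorem12:
  fixes D :: "nat \<Rightarrow> real list set set"
    and \<Theta> Om :: "(real ^ 'm) set"
    and f :: "real ^ 'n \<Rightarrow> real ^ 'm \<Rightarrow> real"
    and JF :: "real ^ ('n + 'm) \<Rightarrow> (real ^ ('n + 'm) ^ 'n) set"
    and eb :: real
    and \<theta> :: "real ^ 'm"
  assumes "o_minimal_structure D"
    and "regularity \<Theta> f"
    and "definable D \<Theta>"
    and "definable_map D (UNIV \<times> \<Theta>) (\<lambda>(x, \<theta>). f x \<theta>)"
    and "Om \<subseteq> \<Theta>" and "open Om" and "definable D Om"
    and "conservative_jacobian (cylinder Om) (grad_x f) JF"
    and "definable_setmap D (cylinder Om) JF"
    and "eb > 0"
    and "uniform_range_condition f JF Om eb"
    and "\<theta> \<in> Om"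
    and "spectral_gap f JF eb \<theta> \<or> fast_vanishing f JF eb \<theta>"
  shows "{- (pinv (Hblock A) ** Mblock A) | A. A \<in> reachable f JF \<theta>} \<subseteq> J_min f JF Om eb \<theta>"
proof clarify
  fix A assume "A \<in> reachable f JF \<theta>"
  then obtain \<epsilon>0 As0 where \<epsilon>0: "decreases_to_zero \<epsilon>0"
    and As0: "\<And>k. As0 k \<in> JF (vjoin (x_eps f (\<epsilon>0 k) \<theta>) \<theta>)" "As0 \<longlonglongrightarrow> A"
    unfolding reachable_def by blast
  have "\<forall>\<^sub>F k in sequentially. \<epsilon>0 k < eb"
    using \<epsilon>0 \<open>eb > 0\<close> by (auto simp: decreases_to_zero_def intro: order_tendstoD)
  \<comment> \<open>\<open>J_min\<close> asks for \<open>\<epsilon> k \<le> eb\<close> at every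
    index, whereas \<open>reachable\<close> sets no upper bound; dropping the first \<open>N\<close>
    terms supplies it.\<close>
  then obtain N where N: "\<And>k. k \<ge> N \<Longrightarrow> \<epsilon>0 k < eb" by (auto simp: eventually_sequentially)
  define \<epsilon> where "\<epsilon> k = \<epsilon>0 (k + N)" for k
  define As where "As k = As0 (k + N)" for k
  have \<epsilon>: "decreases_to_zero \<epsilon>" "\<And>k. \<epsilon> k \<le> eb"
    using decreases_to_zero_subseq[OF \<epsilon>0, of "\<lambda>k. k + N"] N
    by (auto simp: \<epsilon>_def[abs_def] strict_mono_def less_imp_le)
  have As: "\<And>k. As k \<in> JF (vjoin (x_eps f (\<epsilon> k) \<theta>) \<theta>)" "As \<longlonglongrightarrow> A"
    using As0 by (auto simp: \<epsilon>_def As_def[abs_def] LIMSEQ_ignore_initial_segment)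
  obtain r where r: "strict_mono r"
    and lim: "(\<lambda>k. matrix_inv (Hblock (As (r k)) + \<epsilon> (r k) *\<^sub>R mat 1) ** Mblock (As (r k)))
      \<longlonglongrightarrow> pinv (Hblock A) ** Mblock A"
    using regularised_jacobian_subseq_limit[OF assms(13) assms(11) assms(12) \<epsilon> As] by blast
  have "\<theta> \<in> \<Theta>" using assms(5,12) by blast
  then have reg: "C11 (\<lambda>x. f x \<theta>)" "convex_on UNIV (\<lambda>x. f x \<theta>)" "solutions f \<theta> \<noteq> {}"
    using assms(2) by (auto simp: regularity_def)
  have cont: "continuous_on UNIV (\<lambda>x. f x \<theta>)"
    using reg(1) by (auto simp: C11_def intro!: continuous_at_imp_continuous_on differentiable_imp_continuous_within)
  have \<epsilon>r: "decreases_to_zero (\<lambda>k. \<epsilon> (r k))" by (rule decreases_to_zero_subseq[OF \<epsilon>(1) r])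
  then have "(\<lambda>k. x_eps f (\<epsilon> (r k)) \<theta>) \<longlonglongrightarrow> x_min f \<theta>"
    by (intro x_eps_tendsto_x_min cont reg) (auto simp: decreases_to_zero_def)
  moreover have "- (matrix_inv (Hblock (As (r k)) + \<epsilon> (r k) *\<^sub>R mat 1) ** Mblock (As (r k)))
      \<in> J_eps f JF (\<epsilon> (r k)) \<theta>" for k
    unfolding J_eps_def using As(1) by blast
  \<comment> \<open>The parameter sequence is constant at \<open>\<theta>\<close>; the Jacobians are
    the regularised ones along \<open>r\<close>.\<close>
  ultimately show "- (pinv (Hblock A) ** Mblock A) \<in> J_min f JF Om eb \<theta>"
    unfolding J_min_def
    by (intro CollectI exI[of _ "\<lambda>_. \<theta>"] exI[of _ "\<lambda>k. \<epsilon> (r k)"]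
        exI[of _ "\<lambda>k. - (matrix_inv (Hblock (As (r k)) + \<epsilon> (r k) *\<^sub>R mat 1) ** Mblock (As (r k)))"]
        conjI allI tendsto_const tendsto_minus lim \<epsilon>r \<epsilon>(2) assms(12))
qed

end
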